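(* Let $G$ be a locally finite infinite graph with at most countably many ends, and let $k \in \mathbb{N}$ and $q \in \mathbb{Q}$. (i) If $\delta(G) \geq k$, and every end $\omega$ of $G$ satisfies $\delta^+(\omega) \geq k$ witnessed by a defining sequence $C_0 \supseteq C_1 \supseteq \dots$ such that $G - C_n$ is connected for all $n$, then $G$ has a finite subgraph of minimum degree $\geq k$. (ii) If there exists a finite set $S_0 \subseteq V(G)$ such that $d_G(S) \geq q$ for every finite set $S \subseteq V(G)$ containing $S_0$, and every end $\omega$ of $G$ satisfies $d^+(\omega) > q$ witnessed by a defining sequence $C_0 \supseteq C_1 \supseteq \dots$ such that $G - C_n$ is connected for all $n$, then $G$ has a finite subgraph of average degree $> q$.
   Context: An end of $G$ is an equivalence class of rays of $G$, two rays being equivalent if no finite vertex set separates them. For a subgraph or vertex set $U$ of $G$, its vertex boundary is $V^+(U) := N(G-U) \subseteq U$, the set of vertices of $U$ with a neighbour outside $U$. For finite $U$, $d_G(U) := \sum_{v\in U} d_G(v)/|U|$. A region of $G$ is a connected induced subgraph $C$ with finite vertex boundary; with $S := N(C)$ (the finite set of vertices outside $C$ adjacent to $C$), let $G[S,C] := G[S \cup V^+(C)]$ (induced). The minimum out-degree is $\delta_G^+(C) := \min_{v\in V^+(C)} d_{G[S,C]}(v)$ and the average out-degree is $d_G^+(C) :=$ the average of $d_{G[S,C]}(v)$ over $v \in V^+(C)$. A sequence $C_0 \supseteq C_1 \supseteq \dots$ of regions is a defining sequence for an end $\omega$ if every $C_n$ contains a ray from $\omega$ and $\bigcap_n C_n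 = \emptyset$. The minimum limit degree is $\delta^+(\omega) := \sup \lim_{n\to\infty} \delta_G^+(C_n)$ and the average limit degree is $d^+(\omega) := \sup \lim_{n\to\infty} d_G^+(C_n)$, the suprema over all defining sequences of $\omega$ for which the limit exists ($\infty$ allowed). "$\delta^+(\omega)\ge k$ witnessed by a defining sequence $(C_n)$" means that $\lim_n \delta_G^+(C_n)$ exists and is $\ge k$ (similarly for $d^+$ with $>q$).
   Formalization: In (ii) it is additionally assumed that G has at least one end (automatic for connected G); without this (ii) fails, e.g. for infinitely many disjoint triangles with q = 2. *)

theory Defs
  imports Complex_Main "HOL-Library.Countable_Set" "HOL-Library.Extended_Real"
begin

record 'a graph_struct =
  verts :: "'a set"
  edges :: "'a set set"

definition simple_graph :: "'a graph_struct \<Rightarrow> bool" where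
  "simple_graph G \<longleftrightarrow> (\<forall>e\<in>edges G. e \<subseteq> verts G \<and> card e = 2)"

definition nbrs :: "'a graph_struct \<Rightarrow> 'a \<Rightarrow> 'a set" where
  "nbrs G v = {u. {v, u} \<in> edges G}"

definition degree :: "'a graph_struct \<Rightarrow> 'a \<Rightarrow> nat" where
  "degree G v = card (nbrs G v)"

definition locally_finite :: "'a graph_struct \<Rightarrow> bool" where
  "locally_finite G \<longleftrightarrow> (\<forall>v\<in>verts G. finite (nbrs G v))"

definition subgraph :: "'a graph_struct \<Rightarrow> 'a graph_struct \<Rightarrow> bool" where
  "subgraph H G \<longleftrightarrow> simple_graph H \<and> verts H \<subseteq> verts G \<and> edges H \<subseteq> edges G"

definition induced :: "'a graph_struct \<Rightarrow> 'a set \<Rightarrow> 'a graph_struct" where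
  "induced G U = \<lparr>verts = verts G \<inter> U, edges = {e \<in> edges G. e \<subseteq> U}\<rparr>"

definition delete_verts :: "'a graph_struct \<Rightarrow> 'a set \<Rightarrow> 'a graph_struct" where
  "delete_verts G U = induced G (verts G - U)"

definition reachable :: "'a graph_struct \<Rightarrow> 'a \<Rightarrow> 'a \<Rightarrow> bool" where
  "reachable G u v \<longleftrightarrow>
     u \<in> verts G \<and> v \<in> verts G \<and> (\<lambda>x y. {x, y} \<in> edges G)\<^sup>*\<^sup>* u v"

(* The empty graph does not count as connected. *)
definition connected_graph :: "'a graph_struct \<Rightarrow> bool" where
  "connected_graph G \<longleftrightarrow>
     verts G \<noteq> {} \<and> (\<forall>u\<in>verts G. \<forall>v\<in>verts G. reachable G u v)"

definition nbhd :: "'a graph_struct \<Rightarrow> 'a set \<Rightarrow> 'a set" where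
  "nbhd G U = {v \<in> verts G - U. \<exists>u\<in>U. {u, v} \<in> edges G}"

definition boundary :: "'a graph_struct \<Rightarrow> 'a set \<Rightarrow> 'a set" where
  "boundary G U = nbhd G (verts G - U)"

(* An infimum, since the vertex set may be infinite; for a nonempty set of natural
   numbers it is attained.  Meaningful only if the graph has a vertex. *)
definition min_degree :: "'a graph_struct \<Rightarrow> nat" where
  "min_degree G = (INF v\<in>verts G. degree G v)"

(* For finite nonempty U.  The degrees are those in G, not in the subgraph induced by U;
   the average degree of a finite graph H is avg_degree H (verts H). *)
definition avg_degree :: "'a graph_struct \<Rightarrow> 'a set \<Rightarrow> real" where
  "avg_degree G U = (\<Sum>v\<in>U. real (degree G v)) / real (card U)"

(* A ray is encoded by its unique enumeration from its starting vertex. *)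
definition ray :: "'a graph_struct \<Rightarrow> (nat \<Rightarrow> 'a) \<Rightarrow> bool" where
  "ray G r \<longleftrightarrow> inj r \<and> range r \<subseteq> verts G \<and> (\<forall>n. {r n, r (Suc n)} \<in> edges G)"

definition separates :: "'a graph_struct \<Rightarrow> 'a set \<Rightarrow> 'a set \<Rightarrow> 'a set \<Rightarrow> bool" where
  "separates G X A B \<longleftrightarrow> (\<forall>a\<in>A. \<forall>b\<in>B. \<not> reachable (delete_verts G X) a b)"

definition ray_equiv :: "'a graph_struct \<Rightarrow> ((nat \<Rightarrow> 'a) \<times> (nat \<Rightarrow> 'a)) set" where
  "ray_equiv G = {(r, s). ray G r \<and> ray G s \<and>
     \<not> (\<exists>X. finite X \<and> X \<subseteq> verts G \<and> separates G X (range r) (range s))}"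

definition ends :: "'a graph_struct \<Rightarrow> (nat \<Rightarrow> 'a) set set" where
  "ends G = {r. ray G r} // ray_equiv G"

(* Being induced, a region is represented by its vertex set. *)
definition region :: "'a graph_struct \<Rightarrow> 'a set \<Rightarrow> bool" where
  "region G C \<longleftrightarrow>
     C \<subseteq> verts G \<and> connected_graph (induced G C) \<and> finite (boundary G C)"

definition out_graph :: "'a graph_struct \<Rightarrow> 'a set \<Rightarrow> 'a graph_struct" where
  "out_graph G C = induced G (nbhd G C \<union> boundary G C)"

(* The out-degrees are meaningful only if the boundary of C is nonempty; in a defining
   sequence this can fail for at most finitely many members, so limits are unaffected. *)
definition min_out_degree :: "'a graph_struct \<Rightarrow> 'a set \<Rightarrow> nat" where
  "min_out_degree G C = (INF v\<in>boundary G C. degree (out_graph G C) v)"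

definition avg_out_degree :: "'a graph_struct \<Rightarrow> 'a set \<Rightarrow> real" where
  "avg_out_degree G C = avg_degree (out_graph G C) (boundary G C)"

definition defining_sequence ::
    "'a graph_struct \<Rightarrow> (nat \<Rightarrow> 'a) set \<Rightarrow> (nat \<Rightarrow> 'a set) \<Rightarrow> bool" where
  "defining_sequence G \<omega> C \<longleftrightarrow>
     (\<forall>n. region G (C n)) \<and> decseq C \<and>
     (\<forall>n. \<exists>r\<in>\<omega>. range r \<subseteq> C n) \<and> (\<Inter>n. C n) = {}"

definition has_min_limit ::
    "'a graph_struct \<Rightarrow> (nat \<Rightarrow> 'a set) \<Rightarrow> ereal \<Rightarrow> bool" where
  "has_min_limit G C L \<longleftrightarrow> (\<lambda>n. ereal (real (min_out_degree G (C n)))) \<longlonglongrightarrow> L"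

definition has_avg_limit ::
    "'a graph_struct \<Rightarrow> (nat \<Rightarrow> 'a set) \<Rightarrow> ereal \<Rightarrow> bool" where
  "has_avg_limit G C L \<longleftrightarrow> (\<lambda>n. ereal (avg_out_degree G (C n))) \<longlonglongrightarrow> L"

definition min_limit_degree :: "'a graph_struct \<Rightarrow> (nat \<Rightarrow> 'a) set \<Rightarrow> ereal" where
  "min_limit_degree G \<omega> =
     Sup {L. \<exists>C. defining_sequence G \<omega> C \<and> has_min_limit G C L}"

definition avg_limit_degree :: "'a graph_struct \<Rightarrow> (nat \<Rightarrow> 'a) set \<Rightarrow> ereal" where
  "avg_limit_degree G \<omega> =
     Sup {L. \<exists>C. defining_sequence G \<omega> C \<and> has_avg_limit G C L}"

end

theory Submission
  imports Defs
begin

text \<open>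
  A single defining sequence with connected complements forces \<open>G\<close> to be connected. Running through
  the countably many ends, choose for every end not yet covered a region of large out-degree that
  avoids the neighbourhoods of all regions chosen so far; being connected and not inside any of
  them, it is disjoint from them and not adjacent to them. Finitely many of these regions
  already cover all but finitely many vertices, since otherwise Koenig's lemma yields a ray whose end
  is in none of them. Deleting the interiors \<open>C - V\<^sup>+(C)\<close> of these finitely many regions leaves a finite
  graph in which the vertices outside the regions keep their full degree, and each boundary vertex
  keeps at least its out-degree.
\<close>

section \<open>Reachability and connected vertex sets\<close>

lemma reachable_sym: "reachable G u v \<Longrightarrow> reachable G v u"
proof -
  have "symp (\<lambda>x y. {x, y} \<in> edges G)"
    by (simp add: symp_def insert_commute)
  then have "symp (\<lambda>x y. {x, y} \<in> edges G)\<^sup>*\<^sup>*"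
    by (rule symp_rtranclp)
  then show "reachable G u v \<Longrightarrow> reachable G v u"
    unfolding reachable_def by (auto dest: sympD)
qed

lemma induced_verts: "simple_graph G \<Longrightarrow> induced G (verts G) = G"
  by (cases G) (auto simp: induced_def simple_graph_def)

lemma reachable_mono:
  assumes "reachable H u v" "verts H \<subseteq> verts G" "edges H \<subseteq> edges G"
  shows "reachable G u v"
proof -
  have "(\<lambda>x y. {x, y} \<in> edges H)\<^sup>*\<^sup>* u v"
    using assms(1) by (simp add: reachable_def)
  then have "(\<lambda>x y. {x, y} \<in> edges G)\<^sup>*\<^sup>* u v"
    by (rule rev_predicate2D[OF _ rtranclp_mono]) (use assms(3) in auto)
  then show ?thesis using assms(1,2) unfolding reachable_def by auto
qed

text \<open>A walk inside \<open>Y\<close> that starts in \<open>A\<close> could leave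
  \<open>A\<close> only by stepping onto a vertex of \<open>nbhd G A\<close>, and \<open>Y\<close>
  contains none.\<close>

lemma reachable_stays:
  assumes "reachable (induced G Y) x y" "x \<in> A" "Y \<inter> nbhd G A = {}"
    and "simple_graph G"
  shows "y \<in> A"
proof -
  have "(\<lambda>x y. {x, y} \<in> edges (induced G Y))\<^sup>*\<^sup>* x y"
    using assms(1) by (simp add: reachable_def)
  then show ?thesis
  proof induction
    case base
    show ?case by (rule assms(2))
  next
    case (step y z)
    then have "{y, z} \<in> edges G" "z \<in> Y" by (auto simp: induced_def)
    moreover from this have "z \<in> verts G" using assms(4) by (auto simp: simple_graph_def)
    ultimately show ?case using step.IH assms(3) by (auto simp: nbhd_def)
  qed
qed

text \<open>Serves to show that a region avoiding the neighbourhood of another one is either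
  disjoint from it or contained in it.\<close>

lemma connected_induced_subset:
  assumes "connected_graph (induced G Y)" "Y \<subseteq> verts G" "Y \<inter> A \<noteq> {}" "Y \<inter> nbhd G A = {}"
    and "simple_graph G"
  shows "Y \<subseteq> A"
proof
  fix y assume y: "y \<in> Y"
  obtain x where x: "x \<in> Y" "x \<in> A" using assms(3) by blast
  have "verts (induced G Y) = Y" using assms(2) by (auto simp: induced_def)
  then have "reachable (induced G Y) x y"
    using assms(1) x y by (simp add: connected_graph_def)
  from reachable_stays[OF this x(2) assms(4,5)] show "y \<in> A" .
qed

section \<open>Boundaries and neighbourhoods of regions\<close>

lemma simple_graph_edgeD: "simple_graph G \<Longrightarrow> {x, y} \<in> edges G \<Longrightarrow> x \<in> verts G \<and> y \<in> verts G"
  by (auto simp: simple_graph_def)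

lemma boundary_eq: "boundary G C = {v \<in> verts G \<inter> C. \<exists>u\<in>verts G - C. {u, v} \<in> edges G}"
  by (auto simp: boundary_def nbhd_def)

lemma boundary_subset: "boundary G C \<subseteq> C"
  by (auto simp: boundary_eq)

text \<open>Every vertex of the neighbourhood is adjacent to one of the finitely many boundary
  vertices, each of finite degree.\<close>

lemma finite_nbhd_region:
  assumes "simple_graph G" "locally_finite G" "region G C"
  shows "finite (nbhd G C)"
proof (rule finite_subset)
  show "nbhd G C \<subseteq> (\<Union>v\<in>boundary G C. nbrs G v)"
  proof
    fix u assume "u \<in> nbhd G C"
    then obtain v where v: "u \<in> verts G - C" "v \<in> C" "{v, u} \<in> edges G"
      by (auto simp: nbhd_def)
    moreover from v(3) have "{u, v} \<in> edges G" by (simp add: insert_commute)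
    ultimately have "v \<in> boundary G C"
      using simple_graph_edgeD[OF assms(1) v(3)] by (auto simp: boundary_eq)
    with v(3) show "u \<in> (\<Union>v\<in>boundary G C. nbrs G v)" by (auto simp: nbrs_def)
  qed
  show "finite (\<Union>v\<in>boundary G C. nbrs G v)"
    using assms(2,3) by (auto simp: region_def locally_finite_def boundary_eq)
qed

text \<open>The boundary is the neighbourhood of the complement; if it were empty, the connected
  graph \<open>G\<close> would lie inside that complement.\<close>

lemma boundary_nonempty:
  assumes "simple_graph G" "connected_graph G" "C \<subseteq> verts G" "C \<noteq> {}" "C \<noteq> verts G"
  shows "boundary G C \<noteq> {}"
proof
  assume "boundary G C = {}"
  then have "verts G \<inter> nbhd G (verts G - C) = {}" by (simp add: boundary_def)
  moreover have "verts G \<inter> (verts G - C) \<noteq> {}" using assms(3,5) by blast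
  moreover have "connected_graph (induced G (verts G))"
    by (simp only: induced_verts[OF assms(1)] assms(2))
  ultimately have "verts G \<subseteq> verts G - C"
    using connected_induced_subset[OF _ order_refl _ _ assms(1)] by metis
  with assms(3,4) show False by blast
qed

section \<open>Rays from Koenig's lemma\<close>

text \<open>Koenig's lemma on the shortest-path structure rooted at \<open>x0\<close>: follow
  vertices that have infinitely many descendants in every \<open>U n\<close>. A finite
  \<open>X\<close> lies within bounded distance of \<open>x0\<close>, so far along the ray all
  descendants are reached without meeting \<open>X\<close>.\<close>

lemma ray_into_decseq:
  assumes simple: "simple_graph G" and lf: "locally_finite G" and x0: "x0 \<in> verts G"
    and dec: "decseq U" and inf: "\<And>n. infinite (U n)"
    and reach: "\<And>n w. w \<in> U n \<Longrightarrow> reachable G x0 w"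
  obtains R where "ray G R"
    and "\<And>X. finite X \<Longrightarrow>
           \<exists>N. \<forall>j\<ge>N. \<forall>n. infinite {w \<in> U n. reachable (delete_verts G X) (R j) w}"
proof -
  define E where "E = (\<lambda>x y. {x, y} \<in> edges G)"
  \<comment> \<open>The distance from \<open>x0\<close>; its value is arbitrary on vertices that
    \<open>x0\<close> does not reach.\<close>
  define d where "d v = (LEAST n. (E ^^ n) x0 v)" for v
  define down where "down x y \<longleftrightarrow> E x y \<and> d y = Suc (d x)" for x y
  define T where "T v = {w. down\<^sup>*\<^sup>* v w}" for v
  have d_path: "(E ^^ d v) x0 v" if "E\<^sup>*\<^sup>* x0 v" for v
    unfolding d_def by (rule LeastI_ex) (use that in \<open>simp add: rtranclp_power\<close>)
  have d_le: "d v \<le> n" if "(E ^^ n) x0 v" for v n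
    unfolding d_def by (rule Least_le) (rule that)
  \<comment> \<open>Shortest paths consist of \<open>down\<close> steps: the predecessor
    \<open>x\<close> of \<open>v\<close> on one has distance exactly \<open>n\<close>, for otherwise
    \<open>v\<close> would be closer to \<open>x0\<close>.\<close>
  have all_T: "E\<^sup>*\<^sup>* x0 v \<Longrightarrow> v \<in> T x0" for v
  proof (induction "d v" arbitrary: v)
    case 0
    then have "v = x0" using d_path[of v] by simp
    then show ?case by (simp add: T_def)
  next
    case (Suc n)
    have "(E ^^ Suc n) x0 v" using d_path[OF Suc.prems] Suc.hyps(2) by simp
    then obtain x where x: "(E ^^ n) x0 x" "E x v" by auto
    have rx: "E\<^sup>*\<^sup>* x0 x" using x(1) by (auto simp: rtranclp_power)
    have "(E ^^ Suc (d x)) x0 v" using d_path[OF rx] x(2) by auto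
    then have "d v \<le> Suc (d x)" by (rule d_le)
    with d_le[OF x(1)] Suc.hyps(2) have dx: "d x = n" by simp
    have "x \<in> T x0" using Suc.hyps(1)[OF dx[symmetric] rx] .
    moreover have "down x v" using x(2) dx Suc.hyps(2) by (simp add: down_def)
    ultimately show ?case by (auto simp: T_def)
  qed
  define good where "good v \<longleftrightarrow> v \<in> verts G \<and> (\<forall>n. infinite (T v \<inter> U n))" for v
  have "U n \<subseteq> T x0" for n
    using reach[of _ n] all_T by (auto simp: reachable_def E_def)
  then have good0: "good x0"
    using x0 inf by (simp add: good_def Int_absorb1)
  have good_step: "\<exists>y. good y \<and> down v y" if v: "good v" for v
  proof (rule ccontr)
    assume none: "\<not> ?thesis"
    define Y where "Y = {y. down v y}"
    have "Y \<subseteq> nbrs G v" by (auto simp: Y_def down_def E_def nbrs_def)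
    then have finY: "finite Y"
      using lf v by (auto simp: locally_finite_def good_def intro: finite_subset)
    \<comment> \<open>Each child fails to be good at an index of its own. As \<open>U\<close>
      decreases, the failure persists, so the finitely many children share a common index.\<close>
    have "\<forall>\<^sub>F n in sequentially. finite (T y \<inter> U n)" if y: "y \<in> Y" for y
    proof -
      have "y \<in> verts G"
        using y simple_graph_edgeD[OF simple] by (auto simp: Y_def down_def E_def)
      then obtain m where m: "finite (T y \<inter> U m)"
        using none y by (auto simp: good_def Y_def)
      have "finite (T y \<inter> U n)" if "n \<ge> m" for n
        using decseqD[OF dec that] by (intro finite_subset[OF _ m]) auto
      then show ?thesis by (auto simp: eventually_sequentially)
    qed
    then have "\<forall>\<^sub>F n in sequentially. \<forall>y\<in>Y. finite (T y \<inter> U n)"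
      by (intro eventually_ball_finite finY) auto
    then obtain n where n: "\<forall>y\<in>Y. finite (T y \<inter> U n)"
      by (auto simp: eventually_sequentially)
    have "T v \<inter> U n \<subseteq> insert v (\<Union>y\<in>Y. T y \<inter> U n)"
      by (auto simp: T_def Y_def elim: converse_rtranclpE)
    moreover have "finite (\<Union>y\<in>Y. T y \<inter> U n)"
      using n finY by (intro finite_UN_I) auto
    ultimately have "finite (T v \<inter> U n)" by (meson finite_insert finite_subset)
    with v show False by (simp add: good_def)
  qed
  have "\<exists>R. \<forall>j::nat. good (R j) \<and> down (R j) (R (Suc j))"
    by (rule dependent_nat_choice) (use good0 good_step in auto)
  then obtain R where R: "\<And>j. good (R j)" "\<And>j. down (R j) (R (Suc j))"
    by blast
  \<comment> \<open>Growing distance makes \<open>R\<close> injective and lets it escape every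
    finite set.\<close>
  have dR: "d (R j) = d (R 0) + j" for j
    by (induction j) (use R(2) in \<open>auto simp: down_def\<close>)
  show thesis
  proof (rule that)
    have "inj R" by (rule injI) (metis dR add_left_cancel)
    then show "ray G R"
      using R by (auto simp: ray_def good_def down_def E_def)
  next
    fix X :: "'a set"
    assume finX: "finite X"
    \<comment> \<open>Beyond the largest distance occurring in \<open>X\<close>, descending paths
      miss \<open>X\<close>. For empty \<open>X\<close> the value of \<open>Max\<close> is
      unspecified, but then any bound will do.\<close>
    have avoid: "reachable (delete_verts G X) (R j) w"
      if j: "j \<ge> Suc (Max (d ` X))" and w: "w \<in> T (R j)" for j w
    proof -
      have notX: "v \<notin> X" if "d v \<ge> d (R j)" for v
      proof
        assume "v \<in> X"
        then have "d v \<le> Max (d ` X)" using finX by simp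
        with that j dR[of j] show False by simp
      qed
      have Rj: "R j \<in> verts G" using R(1)[of j] by (simp add: good_def)
      have "down\<^sup>*\<^sup>* (R j) w" using w by (simp add: T_def)
      then have "d w \<ge> d (R j) \<and> reachable (delete_verts G X) (R j) w"
      proof induction
        case base
        show ?case using Rj notX by (auto simp: reachable_def delete_verts_def induced_def)
      next
        case (step y z)
        then have e: "{y, z} \<in> edges G" and dz: "d z = Suc (d y)"
          by (auto simp: down_def E_def)
        have "y \<notin> X" "z \<notin> X" using notX step.IH dz by auto
        then have e': "{y, z} \<in> edges (delete_verts G X)" "z \<in> verts (delete_verts G X)"
          using e simple_graph_edgeD[OF simple e] by (auto simp: delete_verts_def induced_def)
        then show ?case using step.IH dz
          by (auto simp: reachable_def intro: rtranclp.rtrancl_into_rtrancl)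
      qed
      then show ?thesis by simp
    qed
    have "infinite {w \<in> U n. reachable (delete_verts G X) (R j) w}"
      if "j \<ge> Suc (Max (d ` X))" for j n
    proof (rule infinite_super)
      show "T (R j) \<inter> U n \<subseteq> {w \<in> U n. reachable (delete_verts G X) (R j) w}"
        using avoid[OF that] by auto
      show "infinite (T (R j) \<inter> U n)" using R(1)[of j] by (simp add: good_def)
    qed
    then show "\<exists>N. \<forall>j\<ge>N. \<forall>n. infinite {w \<in> U n. reachable (delete_verts G X) (R j) w}"
      by blast
  qed
qed

lemma ray_class_in_ends: "ray G r \<Longrightarrow> ray_equiv G `` {r} \<in> ends G"
  by (auto simp: ends_def intro: quotientI)

text \<open>The constant sequence formed by the infinite component of \<open>x0\<close> already
  yields a ray.\<close>

lemma ends_nonempty: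
  assumes "simple_graph G" "locally_finite G" "x0 \<in> verts G" "infinite {w. reachable G x0 w}"
  shows "ends G \<noteq> {}"
proof -
  obtain R where "ray G R"
    by (rule ray_into_decseq[OF assms(1-3), of "\<lambda>_. {w. reachable G x0 w}"])
      (use assms(4) in \<open>auto simp: decseq_def\<close>)
  then show ?thesis using ray_class_in_ends by blast
qed

section \<open>Covering almost all vertices by finitely many separated regions\<close>

text \<open>The predicate \<open>Q\<close> stands for the condition on out-degrees, so that minimum
  and average degree can share the construction.\<close>

lemma finite_region_family:
  assumes simple: "simple_graph G" and lf: "locally_finite G" and inf: "infinite (verts G)"
    and cnt: "countable (ends G)" and conn: "connected_graph G"
    and regions: "\<And>\<omega> X. \<omega> \<in> ends G \<Longrightarrow> finite X \<Longrightarrow>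
      \<exists>C. region G C \<and> Q C \<and> C \<inter> X = {} \<and> (\<exists>r\<in>\<omega>. range r \<subseteq> C)"
  obtains F where "finite F" "F \<noteq> {}" "\<And>C. C \<in> F \<Longrightarrow> region G C \<and> Q C"
    "\<And>C D. C \<in> F \<Longrightarrow> D \<in> F \<Longrightarrow> C \<noteq> D \<Longrightarrow> C \<inter> (D \<union> nbhd G D) = {}"
    "finite (verts G - \<Union>F)"
proof -
  define nice where "nice F \<longleftrightarrow> finite F \<and> (\<forall>C\<in>F. region G C \<and> Q C) \<and>
    (\<forall>C\<in>F. \<forall>D\<in>F. C \<noteq> D \<longrightarrow> C \<inter> (D \<union> nbhd G D) = {})" for F
  have step: "\<exists>F'. nice F' \<and> F \<subseteq> F' \<and> (\<exists>C\<in>F'. \<exists>r\<in>\<omega>. range r \<subseteq> C)"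
    if F: "nice F" and w: "\<omega> \<in> ends G" for F \<omega>
  proof (cases "\<exists>C\<in>F. \<exists>r\<in>\<omega>. range r \<subseteq> C")
    case True
    then show ?thesis using F by blast
  next
    case False
    have "finite (\<Union>C\<in>F. nbhd G C)"
      using F finite_nbhd_region[OF simple lf] by (auto simp: nice_def)
    from regions[OF w this] obtain D r where D: "region G D" "Q D"
      "D \<inter> (\<Union>C\<in>F. nbhd G C) = {}" and r: "r \<in> \<omega>" "range r \<subseteq> D"
      by blast
    have disj: "D \<inter> (C \<union> nbhd G C) = {}" if C: "C \<in> F" for C
    proof -
      have nb: "D \<inter> nbhd G C = {}" using D(3) C by blast
      have "D \<inter> C = {}"
      proof (rule ccontr)
        assume "D \<inter> C \<noteq> {}"
        \<comment> \<open>Containment would put the ray \<open>r\<close> into \<open>C\<close>,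
          making the end of \<open>r\<close> already covered.\<close>
        then have "D \<subseteq> C"
          using D(1) nb simple connected_induced_subset[of G D C] by (simp add: region_def)
        with False C r show False by blast
      qed
      with nb show ?thesis by blast
    qed
    \<comment> \<open>The symmetric condition: an edge from \<open>D\<close> to \<open>C\<close>
      would have its endpoint in \<open>D\<close> lying in \<open>C\<close> or in its
      neighbourhood.\<close>
    have "C \<inter> (D \<union> nbhd G D) = {}" if C: "C \<in> F" for C
    proof -
      have "v \<notin> nbhd G D" if v: "v \<in> C" for v
      proof
        assume "v \<in> nbhd G D"
        then obtain u where u: "u \<in> D" "{u, v} \<in> edges G" by (auto simp: nbhd_def)
        moreover from this have "{v, u} \<in> edges G" "u \<in> verts G"
          using simple_graph_edgeD[OF simple u(2)] by (auto simp: insert_commute)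
        ultimately have "u \<in> C \<union> nbhd G C" using v by (auto simp: nbhd_def)
        with u(1) disj[OF C] show False by blast
      qed
      with disj[OF C] show ?thesis by blast
    qed
    with F disj D(1,2) have "nice (insert D F)" by (auto simp: nice_def)
    with r show ?thesis by blast
  qed
  obtain x0 where x0: "x0 \<in> verts G" using inf by (metis finite.emptyI equals0I)
  have reach: "reachable G x0 w" if "w \<in> verts G" for w
    using conn x0 that by (simp add: connected_graph_def)
  have ne: "ends G \<noteq> {}"
  proof -
    have "{w. reachable G x0 w} = verts G" using reach by (auto simp: reachable_def)
    then show ?thesis using inf by (intro ends_nonempty[OF simple lf x0]) simp
  qed
  \<comment> \<open>An enumeration of the ends, with repetitions if they are finite in number; it
    requires that some end exists.\<close>
  define w where "w = from_nat_into (ends G)"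
  have w: "w n \<in> ends G" for n using ne by (simp add: w_def from_nat_into)
  have "\<exists>F. \<forall>n. nice (F n) \<and> (F n \<subseteq> F (Suc n) \<and> (\<exists>C\<in>F (Suc n). \<exists>r\<in>w n. range r \<subseteq> C))"
  proof (rule dependent_nat_choice)
    show "\<exists>F. nice F" by (rule exI[of _ "{}"]) (simp add: nice_def)
  qed (use step w in blast)
  then obtain F where F: "\<And>n. nice (F n)" "\<And>n. F n \<subseteq> F (Suc n)"
    "\<And>n. \<exists>C\<in>F (Suc n). \<exists>r\<in>w n. range r \<subseteq> C"
    by blast
  have mono: "mono F" using F(2) by (simp add: mono_iff_le_Suc)
  have "\<exists>n. finite (verts G - \<Union>(F n))"
  proof (rule ccontr)
    assume none: "\<not> ?thesis"
    have dec: "decseq (\<lambda>n. verts G - \<Union>(F n))"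
      unfolding decseq_def using monoD[OF mono] by blast
    obtain R where R: "ray G R" and acc: "\<And>X. finite X \<Longrightarrow> \<exists>N. \<forall>j\<ge>N. \<forall>n.
        infinite {v \<in> verts G - \<Union>(F n). reachable (delete_verts G X) (R j) v}"
      by (rule ray_into_decseq[OF simple lf x0 dec]) (use none reach in auto)
    obtain n where n: "w n = ray_equiv G `` {R}"
      \<comment> \<open>The end of \<open>R\<close> occurs in the enumeration, so a region
        \<open>C\<close> chosen by stage \<open>Suc n\<close> contains a ray \<open>r\<close>
        equivalent to \<open>R\<close>.\<close>
      using ray_class_in_ends[OF R] from_nat_into_surj[OF cnt] unfolding w_def by metis
    obtain C r where C: "C \<in> F (Suc n)" "range r \<subseteq> C" and eq: "(R, r) \<in> ray_equiv G"
      using F(3)[of n] n by auto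
    have reg: "region G C" using F(1)[of "Suc n"] C(1) by (auto simp: nice_def)
    let ?S = "nbhd G C"
    have finS: "finite ?S" by (rule finite_nbhd_region[OF simple lf reg])
    obtain N where N: "\<And>j m. j \<ge> N \<Longrightarrow>
        infinite {v \<in> verts G - \<Union>(F m). reachable (delete_verts G ?S) (R j) v}"
      using acc[OF finS] by blast
    \<comment> \<open>Removing the first \<open>N\<close> vertices of \<open>R\<close> as well
      forces the connection between \<open>R\<close> and \<open>r\<close> to use a vertex
      \<open>R j\<close> with \<open>j \<ge> N\<close>.\<close>
    define X where "X = ?S \<union> R ` {..<N}"
    have "finite X" "X \<subseteq> verts G"
      using finS R by (auto simp: X_def nbhd_def ray_def)
    then have "\<not> separates G X (range R) (range r)"
      using eq by (auto simp: ray_equiv_def)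
    then obtain i j where ij: "reachable (delete_verts G X) (R j) (r i)"
      by (auto simp: separates_def)
    have "R j \<notin> X" using ij by (auto simp: reachable_def delete_verts_def induced_def)
    then have jN: "j \<ge> N" by (auto simp: X_def not_le)
    have "R j \<in> C"
      using reachable_stays[of G "verts G - X" "r i" "R j" C] reachable_sym[OF ij] C(2) simple
      by (auto simp: X_def delete_verts_def)
    \<comment> \<open>Since \<open>R j\<close> is in \<open>C\<close>, whatever it reaches off
      \<open>nbhd G C\<close> is in \<open>C\<close> and hence covered, whereas \<open>N\<close>
      promises infinitely many uncovered vertices.\<close>
    then have none: "{v \<in> verts G - \<Union>(F (Suc n)). reachable (delete_verts G ?S) (R j) v} = {}"
      using reachable_stays[of G "verts G - ?S" "R j" _ C] C(1) simple
      by (auto simp: delete_verts_def)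
    from N[OF jN, of "Suc n"] show False unfolding none by simp
  qed
  then obtain n where n: "finite (verts G - \<Union>(F n))" by blast
  show thesis
  proof (rule that[of "F n"])
    show "F n \<noteq> {}" using n inf by auto
  qed (use n F(1)[of n] in \<open>auto simp: nice_def\<close>)
qed

section \<open>Degrees after deleting the interiors of regions\<close>

lemma min_degree_geI:
  "verts G \<noteq> {} \<Longrightarrow> (\<And>v. v \<in> verts G \<Longrightarrow> k \<le> degree G v) \<Longrightarrow> k \<le> min_degree G"
  unfolding min_degree_def by (rule cINF_greatest)

lemma min_degree_le: "v \<in> verts G \<Longrightarrow> min_degree G \<le> degree G v"
  unfolding min_degree_def by (rule cINF_lower) auto

lemma subgraph_induced: "simple_graph G \<Longrightarrow> subgraph (induced G W) G"
  by (auto simp: subgraph_def induced_def simple_graph_def)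

lemma degree_mono:
  assumes "subgraph H G" "locally_finite G" "v \<in> verts G" "nbrs K v \<subseteq> nbrs H v"
  shows "degree K v \<le> degree H v"
proof -
  have "nbrs H v \<subseteq> nbrs G v" using assms(1) by (auto simp: subgraph_def nbrs_def)
  then have "finite (nbrs H v)"
    using assms(2,3) by (auto simp: locally_finite_def intro: finite_subset)
  then show ?thesis unfolding degree_def using assms(4) by (rule card_mono)
qed

text \<open>A neighbour of an uncovered vertex is uncovered or on the boundary of a region. By
  \<open>sep\<close>, the neighbourhood of \<open>C\<close> meets no region of \<open>F\<close>, so
  all vertices of \<open>out_graph G C\<close> survive in \<open>H\<close>.\<close>

lemma regions_degrees:
  assumes simple: "simple_graph G" and lf: "locally_finite G"
    and reg: "\<And>C. C \<in> F \<Longrightarrow> region G C"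
    and sep: "\<And>C D. C \<in> F \<Longrightarrow> D \<in> F \<Longrightarrow> C \<noteq> D \<Longrightarrow> C \<inter> (D \<union> nbhd G D) = {}"
  defines "H \<equiv> induced G ((verts G - \<Union>F) \<union> (\<Union>C\<in>F. boundary G C))"
  shows "verts H = (verts G - \<Union>F) \<union> (\<Union>C\<in>F. boundary G C)"
    and "v \<in> verts G - \<Union>F \<Longrightarrow> degree G v \<le> degree H v"
    and "C \<in> F \<Longrightarrow> v \<in> boundary G C \<Longrightarrow> degree (out_graph G C) v \<le> degree H v"
proof -
  let ?W = "(verts G - \<Union>F) \<union> (\<Union>C\<in>F. boundary G C)"
  show verts: "verts H = ?W" by (auto simp: H_def induced_def boundary_eq)
  have sub: "subgraph H G" unfolding H_def by (rule subgraph_induced[OF simple])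
  show "degree G v \<le> degree H v" if v: "v \<in> verts G - \<Union>F"
  proof (rule degree_mono[OF sub lf])
    have "u \<in> ?W" if e: "{v, u} \<in> edges G" for u
      using simple_graph_edgeD[OF simple e] v e by (auto simp: boundary_eq)
    then show "nbrs G v \<subseteq> nbrs H v" using v by (auto simp: nbrs_def H_def induced_def)
  qed (use v in simp)
  show "degree (out_graph G C) v \<le> degree H v" if C: "C \<in> F" and v: "v \<in> boundary G C"
  proof (rule degree_mono[OF sub lf])
    have "nbhd G C \<union> boundary G C \<subseteq> ?W"
      using C sep by (fastforce simp: nbhd_def)
    then show "nbrs (out_graph G C) v \<subseteq> nbrs H v"
      by (auto simp: nbrs_def H_def out_graph_def induced_def)
  qed (use v in \<open>simp add: boundary_eq\<close>)
qed

section \<open>Regions taken from defining sequences\<close>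

lemma defining_sequence_eventually_avoids:
  assumes "defining_sequence G \<omega> C" "finite X"
  shows "\<forall>\<^sub>F n in sequentially. C n \<inter> X = {}"
proof -
  have dec: "decseq C" and empty: "(\<Inter>n. C n) = {}"
    using assms(1) by (auto simp: defining_sequence_def)
  have "\<forall>\<^sub>F n in sequentially. x \<notin> C n" for x
  proof -
    obtain m where "x \<notin> C m" using empty by auto
    then show ?thesis
      using decseqD[OF dec, of m] by (auto simp: eventually_sequentially)
  qed
  then have "\<forall>\<^sub>F n in sequentially. \<forall>x\<in>X. x \<notin> C n"
    by (intro eventually_ball_finite assms(2)) auto
  then show ?thesis by (rule eventually_mono) blast
qed

text \<open>Any two vertices lie outside some \<open>C n\<close>, and the connected complement of
  that region joins them.\<close>

lemma connected_if_defining_sequence: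
  assumes "defining_sequence G \<omega> C" "\<And>n. connected_graph (delete_verts G (C n))"
    and "verts G \<noteq> {}"
  shows "connected_graph G"
  unfolding connected_graph_def
proof (intro conjI ballI assms(3))
  fix u v assume uv: "u \<in> verts G" "v \<in> verts G"
  have "\<forall>\<^sub>F n in sequentially. C n \<inter> {u, v} = {}"
    by (rule defining_sequence_eventually_avoids[OF assms(1)]) simp
  then obtain n where "C n \<inter> {u, v} = {}" by (auto simp: eventually_sequentially)
  then have "reachable (delete_verts G (C n)) u v"
    using uv assms(2)[of n] by (auto simp: connected_graph_def delete_verts_def induced_def)
  then show "reachable G u v"
    by (rule reachable_mono) (auto simp: delete_verts_def induced_def)
qed

lemma defining_sequence_region:
  assumes simple: "simple_graph G" and conn: "connected_graph G"
    and def: "defining_sequence G \<omega> C" and P: "\<forall>\<^sub>F n in sequentially. P (C n)"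
    and X: "finite X"
  shows "\<exists>D. region G D \<and> (boundary G D \<noteq> {} \<and> P D) \<and> D \<inter> X = {} \<and> (\<exists>r\<in>\<omega>. range r \<subseteq> D)"
proof -
  obtain x0 where x0: "x0 \<in> verts G" using conn by (auto simp: connected_graph_def)
  \<comment> \<open>Excluding \<open>x0\<close> makes the region a proper subset, so its boundary is
    nonempty and its out-degrees are meaningful.\<close>
  have "\<forall>\<^sub>F n in sequentially. P (C n) \<and> C n \<inter> insert x0 X = {}"
    by (rule eventually_conj[OF P defining_sequence_eventually_avoids[OF def]]) (simp add: X)
  then obtain n where n: "P (C n)" "C n \<inter> insert x0 X = {}"
    by (auto simp: eventually_sequentially)
  have reg: "region G (C n)" and ray: "\<exists>r\<in>\<omega>. range r \<subseteq> C n"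
    using def by (auto simp: defining_sequence_def)
  have "boundary G (C n) \<noteq> {}"
    using reg ray x0 n(2) by (intro boundary_nonempty simple conn) (auto simp: region_def)
  with n reg ray show ?thesis by blast
qed

section \<open>Finite subgraphs of large minimum degree\<close>

lemma finite_subgraph_min_degree:
  assumes simple: "simple_graph G" and lf: "locally_finite G" and inf: "infinite (verts G)"
    and cnt: "countable (ends G)" and deg: "k \<le> min_degree G"
    and ends: "\<And>\<omega>. \<omega> \<in> ends G \<Longrightarrow> \<exists>C L. defining_sequence G \<omega> C \<and>
      (\<forall>n. connected_graph (delete_verts G (C n))) \<and> has_min_limit G C L \<and> ereal (real k) \<le> L"
  shows "\<exists>H. subgraph H G \<and> finite (verts H) \<and> verts H \<noteq> {} \<and> k \<le> min_degree H"
proof (cases "ends G = {}")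
  \<comment> \<open>Without ends no defining sequence is at hand to make \<open>G\<close> connected,
    but the component of any vertex is finite and keeps all degrees.\<close>
  case True
  obtain x0 where x0: "x0 \<in> verts G" using inf by (metis finite.emptyI equals0I)
  define K where "K = {v. reachable G x0 v}"
  have K: "K \<subseteq> verts G" by (auto simp: K_def reachable_def)
  have "finite K"
  proof (rule ccontr)
    assume "infinite K"
    with True show False using ends_nonempty[OF simple lf x0] by (simp add: K_def)
  qed
  have sub: "subgraph (induced G K) G" by (rule subgraph_induced[OF simple])
  have "k \<le> degree (induced G K) v" if v: "v \<in> K" for v
  proof -
    have "nbrs G v \<subseteq> K"
      using v simple_graph_edgeD[OF simple]
      by (auto simp: nbrs_def K_def reachable_def intro: rtranclp.rtrancl_into_rtrancl)
    then have "nbrs G v \<subseteq> nbrs (induced G K) v" using v by (auto simp: nbrs_def induced_def)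
    then have "degree G v \<le> degree (induced G K) v"
      using v K by (intro degree_mono[OF sub lf]) auto
    with min_degree_le[of v G] v K deg show ?thesis by fastforce
  qed
  moreover have "verts (induced G K) = K" using K by (auto simp: induced_def)
  moreover have "x0 \<in> K" using x0 by (simp add: K_def reachable_def)
  ultimately show ?thesis
    using sub \<open>finite K\<close> by (intro exI[of _ "induced G K"]) (auto intro!: min_degree_geI)
next
  case False
  then have conn: "connected_graph G"
    using ends connected_if_defining_sequence inf by (metis all_not_in_conv finite.emptyI)
  have regions: "\<exists>D. region G D \<and> (boundary G D \<noteq> {} \<and> k \<le> min_out_degree G D) \<and> D \<inter> X = {} \<and>
      (\<exists>r\<in>\<omega>. range r \<subseteq> D)" if w: "\<omega> \<in> ends G" and X: "finite X" for \<omega> X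
  proof -
    obtain C L where C: "defining_sequence G \<omega> C" "has_min_limit G C L" "ereal (real k) \<le> L"
      using ends[OF w] by blast
    \<comment> \<open>Convergence yields only strict bounds below the limit; for integers, exceeding
      \<open>k - 1/2\<close> means being at least \<open>k\<close>.\<close>
    have "ereal (real k - 1 / 2) < ereal (real k)" by simp
    with C(3) have "ereal (real k - 1 / 2) < L" by (rule order_less_le_trans[rotated])
    with C(2) have "\<forall>\<^sub>F n in sequentially. ereal (real k - 1 / 2) < ereal (real (min_out_degree G (C n)))"
      unfolding has_min_limit_def by (rule order_tendstoD)
    then have "\<forall>\<^sub>F n in sequentially. k \<le> min_out_degree G (C n)"
      by (rule eventually_mono) simp
    from defining_sequence_region[OF simple conn C(1) this X] show ?thesis .
  qed
  obtain F where F: "finite F" "F \<noteq> {}" and reg: "\<And>C. C \<in> F \<Longrightarrow> region G C"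
    and out: "\<And>C. C \<in> F \<Longrightarrow> boundary G C \<noteq> {} \<and> k \<le> min_out_degree G C"
    and sep: "\<And>C D. C \<in> F \<Longrightarrow> D \<in> F \<Longrightarrow> C \<noteq> D \<Longrightarrow> C \<inter> (D \<union> nbhd G D) = {}"
    and fin: "finite (verts G - \<Union>F)"
    by (rule finite_region_family[OF simple lf inf cnt conn regions]) blast+
  define H where "H = induced G ((verts G - \<Union>F) \<union> (\<Union>C\<in>F. boundary G C))"
  have H: "verts H = (verts G - \<Union>F) \<union> (\<Union>C\<in>F. boundary G C)"
    "\<And>v. v \<in> verts G - \<Union>F \<Longrightarrow> degree G v \<le> degree H v"
    "\<And>C v. C \<in> F \<Longrightarrow> v \<in> boundary G C \<Longrightarrow> degree (out_graph G C) v \<le> degree H v"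
    unfolding H_def using regions_degrees[OF simple lf reg sep, of F] by blast+
  have "finite (verts H)" "verts H \<noteq> {}"
    using H(1) F fin reg out by (auto simp: region_def)
  moreover have "k \<le> min_degree H"
  proof (rule min_degree_geI[OF \<open>verts H \<noteq> {}\<close>])
    fix v assume "v \<in> verts H"
    then consider "v \<in> verts G - \<Union>F" | C where "C \<in> F" "v \<in> boundary G C"
      using H(1) by blast
    then show "k \<le> degree H v"
    proof cases
      case 1
      then have "min_degree G \<le> degree G v" by (intro min_degree_le) simp
      with H(2)[of v] 1 deg show ?thesis by simp
    next
      case 2
      have "min_out_degree G C \<le> degree (out_graph G C) v"
        unfolding min_out_degree_def using 2 by (intro cINF_lower) auto
      with H(3)[of C v] 2 out[of C] show ?thesis by simp
    qed
  qed
  moreover have "subgraph H G" unfolding H_def by (rule subgraph_induced[OF simple])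
  ultimately show ?thesis by blast
qed

section \<open>Finite subgraphs of large average degree\<close>

text \<open>Multiplying by \<open>card U\<close> turns a bound on the average into the sign of a
  total excess over \<open>q\<close>, which adds up over disjoint sets.\<close>

lemma avg_degree_iff:
  assumes "finite U" "U \<noteq> {}"
  shows "q < avg_degree G U \<longleftrightarrow> 0 < (\<Sum>v\<in>U. real (degree G v) - q)"
    and "q \<le> avg_degree G U \<longleftrightarrow> 0 \<le> (\<Sum>v\<in>U. real (degree G v) - q)"
proof -
  have "real (card U) > 0" using assms by (simp add: card_gt_0_iff)
  then show "q < avg_degree G U \<longleftrightarrow> 0 < (\<Sum>v\<in>U. real (degree G v) - q)"
    "q \<le> avg_degree G U \<longleftrightarrow> 0 \<le> (\<Sum>v\<in>U. real (degree G v) - q)"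
    by (simp_all add: avg_degree_def sum_subtractf field_simps)
qed

text \<open>The strict inequality comes from the ends. Infinitely many disjoint complete graphs on
  \<open>q + 1\<close> vertices, for a natural number \<open>q\<close>, have no end and no finite
  subgraph of average degree above \<open>q\<close>.\<close>

lemma finite_subgraph_avg_degree:
  fixes q :: real
  assumes simple: "simple_graph G" and lf: "locally_finite G" and inf: "infinite (verts G)"
    and cnt: "countable (ends G)" and ne: "ends G \<noteq> {}" and S0: "finite S0" "S0 \<subseteq> verts G"
    and deg: "\<And>S. finite S \<Longrightarrow> S \<subseteq> verts G \<Longrightarrow> S0 \<subseteq> S \<Longrightarrow> S \<noteq> {} \<Longrightarrow> q \<le> avg_degree G S"
    and ends: "\<And>\<omega>. \<omega> \<in> ends G \<Longrightarrow> \<exists>C L. defining_sequence G \<omega> C \<and>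
      (\<forall>n. connected_graph (delete_verts G (C n))) \<and> has_avg_limit G C L \<and> ereal q < L"
  shows "\<exists>H. subgraph H G \<and> finite (verts H) \<and> verts H \<noteq> {} \<and> q < avg_degree H (verts H)"
proof -
  have conn: "connected_graph G"
    using ne ends connected_if_defining_sequence inf by (metis all_not_in_conv finite.emptyI)
  have regions: "\<exists>D. region G D \<and> (boundary G D \<noteq> {} \<and> q < avg_out_degree G D \<and> D \<inter> S0 = {}) \<and>
      D \<inter> X = {} \<and> (\<exists>r\<in>\<omega>. range r \<subseteq> D)" if w: "\<omega> \<in> ends G" and X: "finite X" for \<omega> X
  proof -
    obtain C L where C: "defining_sequence G \<omega> C" "has_avg_limit G C L" "ereal q < L"
      using ends[OF w] by blast
    have "\<forall>\<^sub>F n in sequentially. ereal q < ereal (avg_out_degree G (C n))"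
      using C(2,3) unfolding has_avg_limit_def by (rule order_tendstoD)
    \<comment> \<open>Regions that miss \<open>S0\<close> leave it uncovered, so \<open>deg\<close>
      applies to the set of uncovered vertices.\<close>
    then have "\<forall>\<^sub>F n in sequentially. q < avg_out_degree G (C n) \<and> C n \<inter> S0 = {}"
      using defining_sequence_eventually_avoids[OF C(1) S0(1)] by (auto elim: eventually_elim2)
    from defining_sequence_region[OF simple conn C(1) this X] show ?thesis .
  qed
  obtain F where F: "finite F" "F \<noteq> {}" and reg: "\<And>C. C \<in> F \<Longrightarrow> region G C"
    and out: "\<And>C. C \<in> F \<Longrightarrow> boundary G C \<noteq> {} \<and> q < avg_out_degree G C \<and> C \<inter> S0 = {}"
    and sep: "\<And>C D. C \<in> F \<Longrightarrow> D \<in> F \<Longrightarrow> C \<noteq> D \<Longrightarrow> C \<inter> (D \<union> nbhd G D) = {}"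
    and fin: "finite (verts G - \<Union>F)"
    by (rule finite_region_family[OF simple lf inf cnt conn regions]) blast+
  define H where "H = induced G ((verts G - \<Union>F) \<union> (\<Union>C\<in>F. boundary G C))"
  have H: "verts H = (verts G - \<Union>F) \<union> (\<Union>C\<in>F. boundary G C)"
    "\<And>v. v \<in> verts G - \<Union>F \<Longrightarrow> degree G v \<le> degree H v"
    "\<And>C v. C \<in> F \<Longrightarrow> v \<in> boundary G C \<Longrightarrow> degree (out_graph G C) v \<le> degree H v"
    unfolding H_def using regions_degrees[OF simple lf reg sep, of F] by blast+
  have finb: "finite (boundary G C)" if "C \<in> F" for C
    using reg[OF that] by (simp add: region_def)
  have finH: "finite (verts H)" and neH: "verts H \<noteq> {}"
    using H(1) F fin finb out by auto
  let ?U = "verts G - \<Union>F"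
  let ?f = "\<lambda>v. real (degree H v) - q"
  have U: "0 \<le> sum ?f ?U"
  \<comment> \<open>If the regions cover everything, \<open>deg\<close> says nothing, but the sum is
    zero.\<close>
  proof (cases "?U = {}")
    case False
    have "S0 \<subseteq> ?U" using S0(2) out by blast
    then have "q \<le> avg_degree G ?U" using False fin by (intro deg) auto
    then have "0 \<le> (\<Sum>v\<in>?U. real (degree G v) - q)"
      using avg_degree_iff(2)[OF fin False] by simp
    also have "\<dots> \<le> sum ?f ?U" using H(2) by (intro sum_mono) simp
    finally show ?thesis .
  qed (metis order_refl sum.empty)
  have B: "0 < sum ?f (boundary G C)" if C: "C \<in> F" for C
  proof -
    have "0 < (\<Sum>v\<in>boundary G C. real (degree (out_graph G C) v) - q)"
      using avg_degree_iff(1)[OF finb[OF C], of q "out_graph G C"] out[OF C]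
      by (simp add: avg_out_degree_def)
    also have "\<dots> \<le> sum ?f (boundary G C)" using H(3) C by (intro sum_mono) simp
    finally show ?thesis .
  qed
  have "sum ?f (verts H) = sum ?f ?U + sum ?f (\<Union>C\<in>F. boundary G C)"
    unfolding H(1) using fin F finb boundary_subset[of G] by (intro sum.union_disjoint) blast+
  also have "sum ?f (\<Union>C\<in>F. boundary G C) = (\<Sum>C\<in>F. sum ?f (boundary G C))"
    using F finb sep boundary_subset[of G] by (intro sum.UNION_disjoint) blast+
  \<comment> \<open>The uncovered vertices contribute at least zero; as \<open>F\<close> is
    nonempty, the boundaries make the total positive.\<close>
  also have "sum ?f ?U + (\<Sum>C\<in>F. sum ?f (boundary G C)) > 0"
    by (intro add_nonneg_pos U sum_pos F B)
  finally have "q < avg_degree H (verts H)"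
    by (subst avg_degree_iff(1)[OF finH neH])
  moreover have "subgraph H G" unfolding H_def by (rule subgraph_induced[OF simple])
  ultimately show ?thesis using finH neH by blast
qed

text \<open>The condition \<open>S \<noteq> {}\<close> matters when \<open>S0\<close> is empty:
  division by zero makes the average over the empty set 0, which would force
  \<open>q \<le> 0\<close>.\<close>

theorem theorem2:
  fixes G :: "'a graph_struct" and k :: nat and q :: rat
  assumes "simple_graph G" and "locally_finite G" and "infinite (verts G)"
    and "countable (ends G)"
  shows
    "(k \<le> min_degree G \<and>
      (\<forall>\<omega>\<in>ends G. ereal (real k) \<le> min_limit_degree G \<omega> \<and>
         (\<exists>C. defining_sequence G \<omega> C \<and> (\<forall>n. connected_graph (delete_verts G (C n))) \<and>
              (\<exists>L. has_min_limit G C L \<and> ereal (real k) \<le> L)))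
      \<longrightarrow> (\<exists>H. subgraph H G \<and> finite (verts H) \<and> verts H \<noteq> {} \<and> k \<le> min_degree H))
     \<and>
     (ends G \<noteq> {} \<and>
      (\<exists>S0. finite S0 \<and> S0 \<subseteq> verts G \<and>
         (\<forall>S. finite S \<and> S \<subseteq> verts G \<and> S0 \<subseteq> S \<and> S \<noteq> {} \<longrightarrow> real_of_rat q \<le> avg_degree G S)) \<and>
      (\<forall>\<omega>\<in>ends G. ereal (real_of_rat q) < avg_limit_degree G \<omega> \<and>
         (\<exists>C. defining_sequence G \<omega> C \<and> (\<forall>n. connected_graph (delete_verts G (C n))) \<and>
              (\<exists>L. has_avg_limit G C L \<and> ereal (real_of_rat q) < L)))
      \<longrightarrow> (\<exists>H. subgraph H G \<and> finite (verts H) \<and> verts H \<noteq> {} \<and>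
               real_of_rat q < avg_degree H (verts H)))"
proof (intro conjI impI, goal_cases)
  case 1
  show ?case
  proof (rule finite_subgraph_min_degree[OF assms conjunct1[OF 1]])
    fix \<omega> assume w: "\<omega> \<in> ends G"
    have "\<exists>C. defining_sequence G \<omega> C \<and>
        (\<forall>n. connected_graph (delete_verts G (C n))) \<and>
        (\<exists>L. has_min_limit G C L \<and> ereal (real k) \<le> L)"
      by (rule conjunct2[OF bspec[OF conjunct2[OF 1] w]])
    then show "\<exists>C L. defining_sequence G \<omega> C \<and> (\<forall>n. connected_graph (delete_verts G (C n))) \<and>
        has_min_limit G C L \<and> ereal (real k) \<le> L"
      by (elim exE conjE) (intro exI conjI)
  qed
next
  case 2
  then obtain S0 where S0: "finite S0" "S0 \<subseteq> verts G"
    and deg: "\<forall>S. finite S \<and> S \<subseteq> verts G \<and> S0 \<subseteq> S \<and> S \<noteq> {} \<longrightarrow> real_of_rat q \<le> avg_degree G S"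
    by (elim conjE exE)
  show ?case
  proof (rule finite_subgraph_avg_degree[OF assms conjunct1[OF 2] S0])
    fix \<omega> assume w: "\<omega> \<in> ends G"
    have "\<exists>C. defining_sequence G \<omega> C \<and>
        (\<forall>n. connected_graph (delete_verts G (C n))) \<and>
        (\<exists>L. has_avg_limit G C L \<and> ereal (real_of_rat q) < L)"
      by (rule conjunct2[OF bspec[OF conjunct2[OF conjunct2[OF 2]] w]])
    then show "\<exists>C L. defining_sequence G \<omega> C \<and> (\<forall>n. connected_graph (delete_verts G (C n))) \<and>
        has_avg_limit G C L \<and> ereal (real_of_rat q) < L"
      by (elim exE conjE) (intro exI conjI)
  qed (use deg in simp)
qed

end
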